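(* Fix an odd prime power $q$ and a symmetric interval $\mathcal I=[-\beta/2,\beta/2]$ with $0<\beta<1$ fixed. Then, for $Q\in\mathcal H_{2g+2,q}$, the interval $\mathcal I$ contains asymptotically $2g|\mathcal I|$ angles $\theta_{j,Q}$ as $g\to\infty$; in fact $$N_{\mathcal I}(Q)=2g|\mathcal I|+O\left(\frac{g}{\log g}\right)\qquad (g\to\infty),$$ uniformly over $Q\in\mathcal H_{2g+2,q}$.
   Context: Let $\mathbb F_q$ be the finite field with $q$ elements, $q$ odd. $\mathcal H_{2g+2,q}$ is the set of monic square-free polynomials $Q\in\mathbb F_q[x]$ of degree $2g+2$. For square-free $Q$ and monic $f$, $\chi_Q(f)=\left(\frac{Q}{f}\right)$ is the Jacobi (quadratic residue) symbol: for $f=P$ monic irreducible not dividing $Q$ it is $\pm1$ according to whether $Q$ is or is not a square mod $P$; it is extended multiplicatively in $f$ and equals $0$ when $\gcd(f,Q)\ne1$. The L-function is $\mathcal L(u,\chi_Q)=\prod_P(1-\chi_Q(P)u^{\deg P})^{-1}$, the product over monic irreducible $P$. For $Q\in\mathcal H_{2g+2,q}$, the function $\mathcal L^*(u,\chi_Q)=(1-u)^{-1}\mathcal L(u,\chi_Q)$ is a polynomial of degree $2g$ (the numerator of the zeta function of the hyperelliptic curve $y^2=Q(x)$), and by Weil's theorem $\mathcal L^*(u,\chi_Q)=\prod_{j=1}^{2g}(1-\sqrt q\,e^{2\pi i\theta_{j,Q}}u)$ with angles $\theta_{j,Q}\in\mathbb R/\mathbb Z$. $N_{\mathcal I}(Q)=\#\{j:\theta_{j,Q}\in\mathcal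 I\}$ (counted with multiplicity), where $\mathcal I$ is regarded in $\mathbb R/\mathbb Z$ and $|\mathcal I|=\beta$. The implied constant may depend on the fixed $q$ and $\mathcal I$. *)

theory Defs
  imports "HOL-Analysis.Analysis" "HOL-Computational_Algebra.Computational_Algebra"
begin

text \<open>
  The finite field with \<open>q\<close> elements is a type \<open>'a :: {field,finite}\<close>, with \<open>q = CARD('a)\<close>.
\<close>

definition monic_squarefree_polys :: "nat \<Rightarrow> 'a::field poly set" where
  "monic_squarefree_polys n = {Q. lead_coeff Q = 1 \<and> squarefree Q \<and> degree Q = n}"

definition monic_irreducible_polys :: "'a::field poly set" where
  "monic_irreducible_polys = {P. lead_coeff P = 1 \<and> irreducible P}"

definition residue_symbol :: "'a::field poly \<Rightarrow> 'a poly \<Rightarrow> int" where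
  "residue_symbol Q P = (if P dvd Q then 0 else if \<exists>h. P dvd Q - h\<^sup>2 then 1 else - 1)"

text \<open>
  The exponent is the multiplicity of \<open>P\<close> in \<open>f\<close>; the library's \<^const>\<open>multiplicity\<close> would
  require more structure on the coefficients than that of a field.
\<close>

definition jacobi_symbol :: "'a::field poly \<Rightarrow> 'a poly \<Rightarrow> int" where
  "jacobi_symbol Q f =
     (\<Prod>P | P \<in> monic_irreducible_polys \<and> P dvd f. residue_symbol Q P ^ (GREATEST n. P ^ n dvd f))"

text \<open>
  The L-function is a formal power series in \<open>u\<close>. Its Euler product is the limit, in the usual
  (\<open>u\<close>-adic) topology of formal power series, of the finite partial products, taken along the
  directed set of all finite sets of monic irreducible polynomials.
\<close>

definition L_function :: "'a::{field,finite} poly \<Rightarrow> complex fps" where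
  "L_function Q =
     Lim (finite_subsets_at_top monic_irreducible_polys)
       (\<lambda>S. \<Prod>P\<in>S. inverse (1 - fps_const (of_int (jacobi_symbol Q P)) * fps_X ^ degree P))"

definition L_star :: "'a::{field,finite} poly \<Rightarrow> complex fps" where
  "L_star Q = inverse (1 - fps_X) * L_function Q"

text \<open>
  The reals \<open>\<theta> 1, \<dots>, \<theta> (2 * g)\<close> represent the angles of \<open>Q\<close>. For \<open>Q\<close> monic and square-free of degree
  \<open>2 * g + 2\<close> they exist by Weil's theorem, and they are unique up to order and modulo 1.
\<close>

definition angles_of :: "'a::{field,finite} poly \<Rightarrow> nat \<Rightarrow> (nat \<Rightarrow> real) \<Rightarrow> bool" where
  "angles_of Q g \<theta> \<longleftrightarrow>
     L_star Q = (\<Prod>j = 1..2 * g.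
       1 - fps_const (of_real (sqrt (real CARD('a))) * exp (2 * of_real pi * \<i> * of_real (\<theta> j))) * fps_X)"

text \<open>
  The number of angles in the image of \<open>I\<close> in the circle of reals modulo 1; counting indices
  rather than values accounts for multiplicity.
\<close>

definition angle_count :: "real set \<Rightarrow> nat \<Rightarrow> (nat \<Rightarrow> real) \<Rightarrow> nat" where
  "angle_count I g \<theta> = card {j \<in> {1..2 * g}. \<exists>m::int. \<theta> j + of_int m \<in> I}"

end

theory Submission
  imports Defs "HOL-Real_Asymp.Real_Asymp"
begin

text \<open>
  For angles \<open>\<theta> 1, \<dots>, \<theta> (2 * g)\<close> of \<open>Q\<close> the proof combines a bound on the power sums
  \<open>\<Sum>j. e(m \<theta>\<^sub>j)\<close>, where \<open>e(x) = exp(2 \<pi> i x)\<close>, with a smoothing argument that turns power sums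
  into a count of angles.

  Power sums. The logarithmic derivative \<open>F \<mapsto> X F' / F\<close> turns products of power series into
  sums. Applied to \<open>L_star Q\<close> it yields, from the product over the angles, the coefficient
  \<open>- q\<^bsup>m/2\<^esup> \<Sum>j. e(m \<theta>\<^sub>j)\<close> at \<open>u\<^sup>m\<close>, and from the Euler product a sum over the monic
  irreducibles of degree at most \<open>m\<close>, of which there are at most \<open>q\<^bsup>m + 1\<^esup>\<close>. So the \<open>m\<close>-th power
  sum is at most \<open>A\<^sup>m\<close> with \<open>A = 2 q\<^sup>2\<close> (\<open>norm_angle_power_sum_le\<close>). Any bound of exponential
  shape would do, because only \<open>m\<close> up to a small multiple of \<open>log g\<close> will be used; in particular
  the trivial bound on the number of irreducibles is enough.

  Smoothing. With \<open>s(x)\<close> the fractional part of \<open>x\<close> minus one half, the indicator function of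
  \<open>[-\<beta>/2, \<beta>/2]\<close> modulo 1 is exactly \<open>\<beta> - s(\<beta>/2 - x) - s(\<beta>/2 + x)\<close>. The function \<open>s\<close> has a
  trigonometric polynomial approximation of degree less than \<open>2 K\<close> whose error is at most a constant
  times \<open>1/(K \<parallel>x\<parallel> + 1/2)\<^sup>2\<close>, and this error is again bounded by a trigonometric polynomial, a sum
  of two Fejer kernels divided by \<open>K\<close>, which has mean value \<open>O(1/K)\<close>. Summing over \<open>N\<close> points whose
  power sums up to \<open>2 K\<close> are at most \<open>B\<close> gives \<open>\<Sum>j. s(y\<^sub>j) = O(N/K + K B)\<close> (\<open>sum_saw_le\<close>),
  without the factor \<open>log K\<close> that smoothing by the Fejer kernel alone would cost.

  With \<open>N = 2 g\<close>, \<open>B = A\<^bsup>2 K\<^esup>\<close> and \<open>K\<close> so small a multiple of \<open>log g\<close> that \<open>B\<close> is at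
  most the square root of \<open>g\<close>, the error is \<open>O(g / log g)\<close>.
\<close>

text \<open>Below, \<open>$\<close> is the coefficient of a power series and not the component of a vector.\<close>

unbundle no vec_syntax

section \<open>Logarithmic derivatives of formal power series\<close>

definition fps_log_deriv :: "'a::field fps \<Rightarrow> 'a fps" where
  "fps_log_deriv F = fps_X * fps_deriv F * inverse F"

lemma fps_log_deriv_1 [simp]: "fps_log_deriv 1 = 0"
  by (simp add: fps_log_deriv_def)

lemma fps_log_deriv_mult:
  assumes "F $ 0 \<noteq> 0" "G $ 0 \<noteq> 0"
  shows "fps_log_deriv (F * G) = fps_log_deriv F + fps_log_deriv G"
proof -
  have "fps_log_deriv (F * G)
      = fps_X * fps_deriv F * inverse F * (G * inverse G)
        + fps_X * fps_deriv G * inverse G * (F * inverse F)"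
    by (simp add: fps_log_deriv_def fps_inverse_mult algebra_simps)
  then show ?thesis
    using assms by (simp add: inverse_mult_eq_1' fps_log_deriv_def)
qed

lemma fps_log_deriv_inverse:
  assumes "F $ 0 \<noteq> 0"
  shows "fps_log_deriv (inverse F) = - fps_log_deriv F"
proof -
  have "fps_log_deriv F + fps_log_deriv (inverse F) = fps_log_deriv (F * inverse F)"
    using assms by (simp add: fps_log_deriv_mult)
  also have "\<dots> = 0"
    using assms by (simp add: inverse_mult_eq_1')
  finally show ?thesis
    by (simp add: eq_neg_iff_add_eq_0 add.commute)
qed

lemma fps_prod_nth_0: "(\<Prod>i\<in>S. F i) $ 0 = (\<Prod>i\<in>S. F i $ 0 :: 'a::comm_ring_1)"
  by (induction S rule: infinite_finite_induct) auto

lemma fps_log_deriv_prod: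
  assumes "\<And>i. i \<in> S \<Longrightarrow> F i $ 0 \<noteq> 0"
  shows "fps_log_deriv (\<Prod>i\<in>S. F i) = (\<Sum>i\<in>S. fps_log_deriv (F i))"
  using assms
  by (induction S rule: infinite_finite_induct) (auto simp: fps_log_deriv_mult fps_prod_nth_0)

lemma fps_mult_low_coeffs_cong:
  assumes "\<forall>i\<le>n. F $ i = F' $ i" "\<forall>i\<le>n. G $ i = G' $ i"
  shows "\<forall>i\<le>n. (F * G) $ i = (F' * G') $ i"
  using assms by (auto simp: fps_mult_nth intro!: sum.cong)

text \<open>
  The quotient \<open>R = F / G\<close> is 1 up to order \<open>n\<close>, so the logarithmic derivative of \<open>R\<close> has no
  coefficient up to \<open>n\<close>. This reduces questions about an infinite Euler product to a finite one.
\<close>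

lemma fps_log_deriv_low_coeffs_cong:
  assumes eq: "\<forall>i\<le>n. F $ i = G $ i" and nz: "G $ 0 \<noteq> 0"
  shows "fps_log_deriv F $ n = fps_log_deriv G $ n"
proof -
  define R where "R = F * inverse G"
  have F: "F = G * R"
    using nz inverse_mult_eq_1'[of G] by (simp add: R_def mult.left_commute)
  have R: "\<forall>i\<le>n. R $ i = (1 :: 'a fps) $ i"
    using fps_mult_low_coeffs_cong[OF eq, of "inverse G" "inverse G"] inverse_mult_eq_1'[OF nz]
    by (simp add: R_def)
  then have "\<forall>i\<le>n. (fps_X * fps_deriv R) $ i = (0 :: 'a fps) $ i"
    by (auto simp: fps_X_mult_nth)
  from fps_mult_low_coeffs_cong[OF this, of "inverse R" "inverse R"] have "fps_log_deriv R $ n = 0"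
    by (simp add: fps_log_deriv_def)
  moreover have "R $ 0 \<noteq> 0"
    using R by simp
  ultimately show ?thesis
    using F nz by (simp add: fps_log_deriv_mult)
qed

lemma fps_inverse_one_minus_monom:
  fixes c :: "'a::field"
  assumes "d > 0"
  shows "inverse (1 - fps_const c * fps_X ^ d)
       = Abs_fps (\<lambda>n. if d dvd n then c ^ (n div d) else 0)" (is "_ = ?W")
proof (rule fps_inverse_unique, rule fps_ext)
  fix n
  have "((1 - fps_const c * fps_X ^ d) * ?W) $ n
      = ?W $ n - c * (if n < d then 0 else ?W $ (n - d))"
    by (simp add: algebra_simps fps_X_power_mult_nth)
  also have "\<dots> = (1 :: 'a fps) $ n"
  proof (cases "n < d")
    case True
    then show ?thesis
      by (auto simp: dvd_imp_le)
  next
    case False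
    then have "c * ?W $ (n - d) = ?W $ n"
      using assms by (auto simp: dvd_minus_self le_div_geq simp flip: power_Suc)
    with False assms show ?thesis
      by auto
  qed
  finally show "((1 - fps_const c * fps_X ^ d) * ?W) $ n = (1 :: 'a fps) $ n" .
qed

lemma fps_log_deriv_one_minus_monom:
  fixes c :: "'a::field"
  assumes "d > 0" "n > 0"
  shows "fps_log_deriv (1 - fps_const c * fps_X ^ d) $ n
       = (if d dvd n then - of_nat d * c ^ (n div d) else 0)"
proof -
  have "fps_X * fps_deriv (1 - fps_const c * fps_X ^ d) = fps_X ^ d * fps_const (- of_nat d * c)"
  proof (rule fps_ext)
    fix k
    show "(fps_X * fps_deriv (1 - fps_const c * fps_X ^ d)) $ k
        = (fps_X ^ d * fps_const (- of_nat d * c)) $ k"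
      using assms by (cases k) (auto simp: fps_X_power_nth fps_X_power_mult_nth)
  qed
  then have "fps_log_deriv (1 - fps_const c * fps_X ^ d) $ n
      = (if n < d then 0 else - of_nat d * c * (if d dvd n - d then c ^ ((n - d) div d) else 0))"
    using assms
    by (simp add: fps_log_deriv_def fps_inverse_one_minus_monom fps_X_power_mult_nth mult.assoc)
  also have "\<dots> = (if d dvd n then - of_nat d * c ^ (n div d) else 0)"
    using assms by (auto simp: dvd_minus_self le_div_geq dvd_imp_le simp flip: power_Suc)
  finally show ?thesis .
qed

section \<open>Power sums of the angles\<close>

text \<open>
  A polynomial of degree at most \<open>n\<close> is given by its list of \<open>n + 1\<close> lowest coefficients.
\<close>

lemma card_polys_degree_le:
  "finite {p :: 'a::{field,finite} poly. degree p \<le> n}"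
  "card {p :: 'a::{field,finite} poly. degree p \<le> n} \<le> CARD('a) ^ Suc n"
proof -
  let ?L = "{xs :: 'a list. set xs \<subseteq> UNIV \<and> length xs = Suc n}"
  have sub: "{p :: 'a poly. degree p \<le> n} \<subseteq> Poly ` ?L"
  proof
    fix p :: "'a poly"
    assume "p \<in> {p. degree p \<le> n}"
    then have "coeff p i = nth_default 0 (map (coeff p) [0..<Suc n]) i" for i
      by (auto simp: nth_default_def coeff_eq_0 less_Suc_eq simp del: upt_Suc)
    then have "p = Poly (map (coeff p) [0..<Suc n])"
      by (simp add: poly_eq_iff coeff_Poly_eq del: upt_Suc)
    then show "p \<in> Poly ` ?L"
      by (rule image_eqI) simp
  qed
  have L: "finite ?L" "card ?L = CARD('a) ^ Suc n"
    by (rule finite_lists_length_eq card_lists_length_eq, rule finite)+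
  show "finite {p :: 'a poly. degree p \<le> n}"
    using sub L finite_surj by blast
  show "card {p :: 'a poly. degree p \<le> n} \<le> CARD('a) ^ Suc n"
    using surj_card_le[OF L(1) sub] L(2) by simp
qed

lemma degree_irreducible_pos:
  fixes P :: "'a::field poly"
  assumes "irreducible P"
  shows "degree P > 0"
  using assms by (metis irreducible_def is_unit_iff_degree gr0I)

lemma abs_jacobi_symbol_le_1: "\<bar>jacobi_symbol Q f\<bar> \<le> 1"
proof -
  have "\<bar>jacobi_symbol Q f\<bar> = (\<Prod>P | P \<in> monic_irreducible_polys \<and> P dvd f.
      \<bar>residue_symbol Q P\<bar> ^ (GREATEST n. P ^ n dvd f))"
    by (simp add: jacobi_symbol_def abs_prod power_abs)
  also have "\<dots> \<le> 1"
    by (intro prod_le_1) (auto simp: residue_symbol_def power_0_left)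
  finally show ?thesis .
qed

definition euler_factor :: "'a::field poly \<Rightarrow> 'a poly \<Rightarrow> complex fps" where
  "euler_factor Q P = inverse (1 - fps_const (of_int (jacobi_symbol Q P)) * fps_X ^ degree P)"

lemma euler_factor_nth_below_degree:
  assumes "irreducible P" "k < degree P"
  shows "euler_factor Q P $ k = (if k = 0 then 1 else 0)"
  using assms degree_irreducible_pos[of P]
  by (auto simp: euler_factor_def fps_inverse_one_minus_monom dest: dvd_imp_le)

lemma norm_log_deriv_euler_factor_le:
  assumes "irreducible P" "n > 0"
  shows "norm (fps_log_deriv (euler_factor Q P) $ n) \<le> (if degree P \<le> n then real n else 0)"
proof -
  let ?c = "of_int (jacobi_symbol Q P) :: complex"
  have d: "degree P > 0"
    using assms degree_irreducible_pos by blast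
  have "fps_log_deriv (euler_factor Q P) $ n
      = - (if degree P dvd n then - of_nat (degree P) * ?c ^ (n div degree P) else 0)"
    using d assms
    by (simp add: euler_factor_def fps_log_deriv_inverse fps_log_deriv_one_minus_monom)
  moreover have "norm ?c \<le> 1"
    using abs_jacobi_symbol_le_1[of Q P] by (simp flip: of_int_abs)
  then have "norm ?c ^ k \<le> 1" for k
    by (simp add: power_le_one)
  then have "real (degree P) * norm ?c ^ (n div degree P) \<le> real (degree P) * 1"
    by (intro mult_left_mono) auto
  ultimately show ?thesis
    using assms by (auto simp: norm_mult norm_power dest: dvd_imp_le)
qed

text \<open>
  An irreducible of degree above \<open>n\<close> contributes an Euler factor that is 1 up to order \<open>n\<close>.
  Hence each coefficient of the partial products is eventually constant along the directed set of
  finite sets of irreducibles: the limit defining \<^const>\<open>L_function\<close> exists, and its first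
  coefficients are those of a finite product.
\<close>

lemma L_function_eq_partial_euler_product:
  fixes Q :: "'a::{field,finite} poly"
  shows "\<forall>i\<le>n. L_function Q $ i
    = (\<Prod>P | P \<in> monic_irreducible_polys \<and> degree P \<le> n. euler_factor Q P) $ i"
proof -
  define S where "S m = {P \<in> monic_irreducible_polys :: 'a poly set. degree P \<le> m}" for m
  have fin: "finite (S m)" for m
    by (rule finite_subset[OF _ card_polys_degree_le(1)[of m]]) (auto simp: S_def)
  have stable: "(\<Prod>P\<in>T. euler_factor Q P) $ i = (\<Prod>P\<in>S m. euler_factor Q P) $ i"
    if "finite T" "S m \<subseteq> T" "T \<subseteq> monic_irreducible_polys" "i \<le> m" for T m i
  proof -
    have *: "\<forall>i\<le>m. (\<Prod>P\<in>U. euler_factor Q P) $ i = (1 :: complex fps) $ i"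
      if "finite U" "\<forall>P\<in>U. irreducible P \<and> m < degree P" for U
      using that
    proof (induction U rule: finite_induct)
      case (insert P U)
      then have "\<forall>i\<le>m. euler_factor Q P $ i = (1 :: complex fps) $ i"
        by (auto simp: euler_factor_nth_below_degree)
      moreover have "\<forall>i\<le>m. (\<Prod>P\<in>U. euler_factor Q P) $ i = (1 :: complex fps) $ i"
        using insert by blast
      ultimately show ?case
        using fps_mult_low_coeffs_cong[of m "euler_factor Q P" 1 "\<Prod>P\<in>U. euler_factor Q P" 1]
          insert.hyps
        by (simp only: prod.insert mult_1_right not_False_eq_True)
    qed simp
    have "(\<Prod>P\<in>T. euler_factor Q P)
        = (\<Prod>P\<in>S m. euler_factor Q P) * (\<Prod>P\<in>T - S m. euler_factor Q P)"
      using that by (subst mult.commute, intro prod.subset_diff) auto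
    moreover have "\<forall>P\<in>T - S m. irreducible P \<and> m < degree P"
      using that by (auto simp: S_def monic_irreducible_polys_def)
    then have "\<forall>i\<le>m. (\<Prod>P\<in>T - S m. euler_factor Q P) $ i = (1 :: complex fps) $ i"
      using \<open>finite T\<close> by (intro *) auto
    then have "\<forall>i\<le>m. ((\<Prod>P\<in>S m. euler_factor Q P) * (\<Prod>P\<in>T - S m. euler_factor Q P)) $ i
        = ((\<Prod>P\<in>S m. euler_factor Q P) * 1) $ i"
      by (intro fps_mult_low_coeffs_cong) auto
    ultimately show ?thesis
      using that by simp
  qed
  define L where "L = Abs_fps (\<lambda>m. (\<Prod>P\<in>S m. euler_factor Q P) $ m)"
  have "((\<lambda>T. \<Prod>P\<in>T. euler_factor Q P) \<longlongrightarrow> L) (finite_subsets_at_top monic_irreducible_polys)"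
  proof (rule tendsto_fpsI)
    fix m
    show "\<forall>\<^sub>F T in finite_subsets_at_top monic_irreducible_polys.
        (\<Prod>P\<in>T. euler_factor Q P) $ m = L $ m"
      unfolding eventually_finite_subsets_at_top
      by (rule exI[of _ "S m"]) (use fin stable in \<open>auto simp: L_def S_def\<close>)
  qed
  then have "L_function Q = L"
    by (simp add: L_function_def euler_factor_def tendsto_Lim)
  moreover have "(\<Prod>P\<in>S n. euler_factor Q P) $ i = (\<Prod>P\<in>S i. euler_factor Q P) $ i"
    if "i \<le> n" for i
    by (rule stable[OF fin]) (use that in \<open>auto simp: S_def\<close>)
  ultimately show ?thesis
    by (simp add: L_def S_def)
qed

lemma norm_log_deriv_L_function_le:
  fixes Q :: "'a::{field,finite} poly"
  assumes "n > 0"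
  shows "norm (fps_log_deriv (L_function Q) $ n) \<le> real n * real CARD('a) ^ Suc n"
proof -
  define S where "S = {P \<in> monic_irreducible_polys :: 'a poly set. degree P \<le> n}"
  have irr: "irreducible P" if "P \<in> S" for P
    using that by (simp add: S_def monic_irreducible_polys_def)
  have one: "euler_factor Q P $ 0 = 1" if "P \<in> S" for P
    using irr[OF that] degree_irreducible_pos[of P] by (simp add: euler_factor_nth_below_degree)
  have "fps_log_deriv (L_function Q) $ n = fps_log_deriv (\<Prod>P\<in>S. euler_factor Q P) $ n"
    using L_function_eq_partial_euler_product[of n Q] one
    by (intro fps_log_deriv_low_coeffs_cong) (auto simp: S_def fps_prod_nth_0)
  also have "\<dots> = (\<Sum>P\<in>S. fps_log_deriv (euler_factor Q P) $ n)"
    using one by (simp add: fps_log_deriv_prod fps_sum_nth)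
  also have "norm \<dots> \<le> (\<Sum>P\<in>S. real n)"
    using norm_log_deriv_euler_factor_le[OF irr assms]
    by (intro sum_norm_le) (auto simp: S_def)
  also have "\<dots> = real (card S) * real n"
    by simp
  finally have "norm (fps_log_deriv (L_function Q) $ n) \<le> real (card S) * real n" .
  also have "card S \<le> card {p :: 'a poly. degree p \<le> n}"
    using card_polys_degree_le(1) by (intro card_mono) (auto simp: S_def)
  then have "real (card S) * real n \<le> real (CARD('a) ^ Suc n) * real n"
    using card_polys_degree_le(2)[where ?'a = 'a, of n]
    by (intro mult_right_mono) linarith+
  finally show ?thesis
    by (simp add: mult.commute)
qed

text \<open>
  Both sides of the equation in \<^const>\<open>angles_of\<close> are products, and the logarithmic derivative
  compares them coefficientwise. The Riemann hypothesis enters only through the shape of the angle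
  product, whose inverse roots all have modulus equal to the square root of \<open>q\<close>. That factor is at
  least 1 and is simply dropped.
\<close>

lemma norm_angle_power_sum_le:
  fixes Q :: "'a::{field,finite} poly"
  assumes "angles_of Q g \<theta>" "n > 0"
  shows "norm (\<Sum>j = 1..2 * g. cis (2 * pi * (real n * \<theta> j))) \<le> (2 * real CARD('a) ^ 2) ^ n"
proof -
  let ?q = "real CARD('a)"
  define a where "a j = complex_of_real (sqrt ?q) * exp (2 * of_real pi * \<i> * of_real (\<theta> j))" for j
  have a: "a j = of_real (sqrt ?q) * cis (2 * pi * \<theta> j)" for j
    by (simp add: a_def cis_conv_exp mult_ac)
  have q: "?q \<ge> 1"
    by (simp add: Suc_le_eq)
  have L0: "L_function Q $ 0 = 1"
  proof -
    have "euler_factor Q P $ 0 = 1" if "P \<in> monic_irreducible_polys" for P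
      using that degree_irreducible_pos[of P]
      by (simp add: monic_irreducible_polys_def euler_factor_nth_below_degree)
    then show ?thesis
      using L_function_eq_partial_euler_product[of 0 Q] by (simp add: fps_prod_nth_0)
  qed
  have X: "fps_log_deriv (1 - fps_X :: complex fps) $ n = - 1"
    using fps_log_deriv_one_minus_monom[of 1 n "1::complex"] assms by simp
  have "fps_log_deriv (L_star Q) $ n
      = (\<Sum>j = 1..2 * g. fps_log_deriv (1 - fps_const (a j) * fps_X ^ 1) $ n)"
    using assms(1) by (simp add: angles_of_def a_def fps_log_deriv_prod fps_sum_nth)
  also have "\<dots> = - (\<Sum>j = 1..2 * g. a j ^ n)"
    using assms(2) by (subst fps_log_deriv_one_minus_monom) (simp_all add: sum_negf)
  finally have "(\<Sum>j = 1..2 * g. a j ^ n) = - fps_log_deriv (L_star Q) $ n"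
    by simp
  also have "\<dots> = - 1 - fps_log_deriv (L_function Q) $ n"
    using L0 X by (simp add: L_star_def fps_log_deriv_mult fps_log_deriv_inverse)
  also have "norm \<dots> \<le> 1 + real n * ?q ^ Suc n"
    using norm_log_deriv_L_function_le[OF assms(2), of Q]
    by (intro order.trans[OF norm_triangle_ineq4]) auto
  also have "\<dots> \<le> (2 * ?q ^ 2) ^ n"
  proof -
    have "1 + real n * ?q ^ Suc n \<le> ?q ^ (2 * n) + real n * ?q ^ (2 * n)"
      using q assms(2) by (intro add_mono mult_left_mono power_increasing) auto
    also have "\<dots> = real (Suc n) * ?q ^ (2 * n)"
      by (simp add: algebra_simps)
    also have "\<dots> \<le> 2 ^ n * ?q ^ (2 * n)"
    proof (intro mult_right_mono)
      have "Suc n \<le> 2 ^ n"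
        using less_exp[of n] by (simp add: Suc_le_eq)
      then show "real (Suc n) \<le> 2 ^ n"
        by (metis of_nat_le_iff of_nat_numeral of_nat_power)
    qed simp
    finally show ?thesis
      by (simp add: power_mult_distrib power_mult)
  qed
  finally have bound: "norm (\<Sum>j = 1..2 * g. a j ^ n) \<le> (2 * ?q ^ 2) ^ n" .
  have "(\<Sum>j = 1..2 * g. a j ^ n)
      = of_real (sqrt ?q ^ n) * (\<Sum>j = 1..2 * g. cis (2 * pi * (real n * \<theta> j)))"
    by (simp add: a power_mult_distrib Complex.DeMoivre sum_distrib_left mult.left_commute)
  then have "norm (\<Sum>j = 1..2 * g. a j ^ n)
      = sqrt ?q ^ n * norm (\<Sum>j = 1..2 * g. cis (2 * pi * (real n * \<theta> j)))"
    by (simp add: norm_mult norm_power)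
  moreover have "1 \<le> sqrt ?q ^ n"
    using q by (intro one_le_power) simp
  ultimately have "norm (\<Sum>j = 1..2 * g. cis (2 * pi * (real n * \<theta> j)))
      \<le> norm (\<Sum>j = 1..2 * g. a j ^ n)"
    using mult_right_mono[of 1 "sqrt ?q ^ n"] by simp
  with bound show ?thesis
    by simp
qed

section \<open>Trigonometric approximation of the sawtooth function\<close>

definition unit_char :: "real \<Rightarrow> complex" where
  "unit_char x = cis (2 * pi * x)"

lemma norm_unit_char [simp]: "norm (unit_char x) = 1"
  by (simp add: unit_char_def)

lemma unit_char_0 [simp]: "unit_char 0 = 1"
  by (simp add: unit_char_def)

lemma unit_char_add: "unit_char (x + y) = unit_char x * unit_char y"
  by (simp add: unit_char_def cis_mult algebra_simps)

lemma cnj_unit_char: "cnj (unit_char x) = unit_char (- x)"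
  by (simp add: unit_char_def cis_cnj)

lemma unit_char_of_int [simp]: "unit_char (of_int m) = 1"
  by (simp add: unit_char_def cis_multiple_2pi)

lemma unit_char_power: "unit_char x ^ n = unit_char (real n * x)"
  by (simp add: unit_char_def Complex.DeMoivre mult_ac)

lemma Re_unit_char: "Re (unit_char x) = cos (2 * pi * x)"
  by (simp add: unit_char_def)

lemma Im_unit_char: "Im (unit_char x) = sin (2 * pi * x)"
  by (simp add: unit_char_def)

lemma norm_one_minus_unit_char_sq: "norm (1 - unit_char x) ^ 2 = 2 - 2 * cos (2 * pi * x)"
proof -
  have "norm (1 - unit_char x) ^ 2 = (1 - cos (2 * pi * x)) ^ 2 + sin (2 * pi * x) ^ 2"
    by (simp add: cmod_power2 Re_unit_char Im_unit_char)
  also have "\<dots> = 1 - 2 * cos (2 * pi * x) + (sin (2 * pi * x) ^ 2 + cos (2 * pi * x) ^ 2)"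
    by (simp add: power2_eq_square algebra_simps)
  finally show ?thesis
    by simp
qed

lemma norm_one_minus_unit_char: "norm (1 - unit_char x) = 2 * \<bar>sin (pi * x)\<bar>"
proof -
  have "norm (1 - unit_char x) ^ 2 = (2 * \<bar>sin (pi * x)\<bar>) ^ 2"
    using cos_double_sin[of "pi * x"]
    by (simp add: norm_one_minus_unit_char_sq power_mult_distrib mult.assoc)
  then show ?thesis
    by (rule power2_eq_imp_eq) auto
qed

lemma norm_one_minus_unit_char_le: "norm (1 - unit_char x) \<le> 2 * pi * \<bar>x\<bar>"
  using abs_sin_x_le_abs_x[of "pi * x"] by (simp add: norm_one_minus_unit_char abs_mult)

lemma norm_one_minus_unit_char_ge:
  assumes "0 \<le> x" "x \<le> 1/2"
  shows "2 * x \<le> norm (1 - unit_char x)"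
proof -
  have "x \<le> sin (pi * x)"
  proof (cases "x \<le> 1/3")
    case True
    have *: "\<exists>y. ((\<lambda>x. sin (pi * x) - x) has_real_derivative y) (at t) \<and> y \<ge> 0"
      if "0 \<le> t" "t \<le> x" for t
    proof (intro exI conjI)
      show "((\<lambda>x. sin (pi * x) - x) has_real_derivative (cos (pi * t) * pi - 1)) (at t)"
        by (auto intro!: derivative_eq_intros)
      have "cos (pi / 3) \<le> cos (pi * t)"
        using that True by (intro cos_monotone_0_pi_le) (auto simp: field_simps)
      then have "1 / 2 * 2 \<le> cos (pi * t) * pi"
        using pi_ge_two by (intro mult_mono) (auto simp: cos_60)
      then show "0 \<le> cos (pi * t) * pi - 1"
        by simp
    qed
    from DERIV_nonneg_imp_nondecreasing[OF assms(1) this] show ?thesis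
      by simp
  next
    case False
    have "sqrt 3 / 2 \<le> sin (pi * x)"
      using False assms sin_monotone_2pi_le[of "pi / 3" "pi * x"]
      by (auto simp: sin_60 field_simps)
    moreover have "1 \<le> sqrt 3"
      by simp
    ultimately show ?thesis
      using assms by linarith
  qed
  with assms show ?thesis
    by (simp add: norm_one_minus_unit_char)
qed

definition dirichlet_sum :: "nat \<Rightarrow> real \<Rightarrow> complex" where
  "dirichlet_sum K x = (\<Sum>k<K. unit_char (real k * x))"

text \<open>
  The closed form of the geometric sum, multiplied out so that it also holds at integers.
\<close>

lemma dirichlet_sum_mult:
  "norm (dirichlet_sum K x) * norm (1 - unit_char x) = norm (1 - unit_char (real K * x))"
proof -
  have "1 - unit_char x ^ K = (1 - unit_char x) * dirichlet_sum K x"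
    by (simp add: one_diff_power_eq dirichlet_sum_def flip: unit_char_power)
  then show ?thesis
    by (simp add: unit_char_power norm_mult mult.commute)
qed

lemma dirichlet_sum_add_of_int:
  "dirichlet_sum K (x + of_int m) = dirichlet_sum K x"
proof -
  have "unit_char (real k * (x + of_int m)) = unit_char (real k * x)" for k
    using unit_char_of_int[of "int k * m"] by (simp add: distrib_left unit_char_add)
  then show ?thesis
    by (simp add: dirichlet_sum_def)
qed

text \<open>
  The squared modulus of a Dirichlet sum is indexed by pairs of exponents, and the fourth power by
  pairs of pairs. Keeping these index sets, instead of collecting equal frequencies, avoids explicit
  Fourier coefficients: such a sum is bounded term by term.
\<close>

definition pair_freq :: "nat \<times> nat \<Rightarrow> int" where
  "pair_freq p = int (fst p) - int (snd p)"

definition quad_freq :: "(nat \<times> nat) \<times> (nat \<times> nat) \<Rightarrow> int" where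
  "quad_freq t = pair_freq (fst t) + pair_freq (snd t)"

abbreviation pairs :: "nat \<Rightarrow> (nat \<times> nat) set" where
  "pairs K \<equiv> {..<K} \<times> {..<K}"

abbreviation quads :: "nat \<Rightarrow> ((nat \<times> nat) \<times> (nat \<times> nat)) set" where
  "quads K \<equiv> pairs K \<times> pairs K"

lemma dirichlet_sum_norm_sq:
  "complex_of_real (norm (dirichlet_sum K x) ^ 2)
     = (\<Sum>p\<in>pairs K. unit_char (of_int (pair_freq p) * x))"
  unfolding complex_norm_square dirichlet_sum_def cnj_sum sum_product sum.cartesian_product
  by (intro sum.cong)
    (auto simp: pair_freq_def cnj_unit_char algebra_simps simp flip: unit_char_add)

lemma dirichlet_sum_norm_pow4:
  "norm (dirichlet_sum K x) ^ 4 = (\<Sum>t\<in>quads K. cos (2 * pi * (of_int (quad_freq t) * x)))"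
proof -
  have "complex_of_real (norm (dirichlet_sum K x) ^ 4)
      = complex_of_real (norm (dirichlet_sum K x) ^ 2) * complex_of_real (norm (dirichlet_sum K x) ^ 2)"
    by (simp flip: power_add)
  also have "\<dots> = (\<Sum>t\<in>quads K. unit_char (of_int (quad_freq t) * x))"
    unfolding dirichlet_sum_norm_sq sum_product sum.cartesian_product
    by (intro sum.cong) (auto simp: quad_freq_def unit_char_add algebra_simps)
  finally have "Re (complex_of_real (norm (dirichlet_sum K x) ^ 4))
      = Re (\<Sum>t\<in>quads K. unit_char (of_int (quad_freq t) * x))"
    by (rule arg_cong)
  then show ?thesis
    by (simp only: Re_complex_of_real Re_sum Re_unit_char)
qed

text \<open>
  The additive energy of \<open>{0, \<dots>, K - 1}\<close>, which is the mean value of the fourth power of the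
  modulus of the Dirichlet sum. Dividing that power by it gives the Jackson kernel.
\<close>

definition energy :: "nat \<Rightarrow> real" where
  "energy K = real (card {t \<in> quads K. quad_freq t = 0})"

text \<open>
  If \<open>a\<close>, \<open>b\<close>, \<open>c\<close> are in the middle third, then \<open>a + b - c\<close> is still in the full range, so
  the equation \<open>a + b = c + d\<close> has at least \<open>n\<^sup>3\<close> solutions.
\<close>

lemma energy_ge: "real n ^ 3 \<le> energy (3 * n)"
proof -
  let ?B = "{n..<2*n} \<times> {n..<2*n} \<times> {n..<2*n}"
  let ?f = "\<lambda>(a, b, c). ((a, c), (b, a + b - c)) :: (nat \<times> nat) \<times> (nat \<times> nat)"
  have "card ?B \<le> card {t \<in> quads (3 * n). quad_freq t = 0}"
  proof (rule card_inj_on_le[of ?f])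
    show "inj_on ?f ?B"
      by (auto simp: inj_on_def)
    show "?f ` ?B \<subseteq> {t \<in> quads (3 * n). quad_freq t = 0}"
      by (auto simp: quad_freq_def pair_freq_def of_nat_diff)
  qed auto
  then have "n ^ 3 \<le> card {t \<in> quads (3 * n). quad_freq t = 0}"
    by (simp add: card_cartesian_product power3_eq_cube mult.assoc)
  then have "real (n ^ 3) \<le> energy (3 * n)"
    unfolding energy_def by (simp only: of_nat_le_iff)
  then show ?thesis
    by simp
qed

definition saw :: "real \<Rightarrow> real" where
  "saw x = frac x - 1 / 2"

text \<open>
  The convolution of the sawtooth function with the Jackson kernel, as the termwise antiderivative of
  \<open>1 - J\<close> for the Jackson kernel \<open>J\<close>.
\<close>

definition saw_poly :: "nat \<Rightarrow> real \<Rightarrow> real" where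
  "saw_poly K x = - (\<Sum>t\<in>{t \<in> quads K. quad_freq t \<noteq> 0}.
     sin (2 * pi * (of_int (quad_freq t) * x)) / (2 * pi * of_int (quad_freq t))) / energy K"

lemma saw_poly_deriv:
  assumes "energy K > 0"
  shows "(saw_poly K has_real_derivative 1 - norm (dirichlet_sum K x) ^ 4 / energy K) (at x)"
proof -
  let ?N = "{t \<in> quads K. quad_freq t \<noteq> 0}" and ?C = "{t \<in> quads K. quad_freq t = 0}"
  let ?cos = "\<lambda>t. cos (2 * pi * (of_int (quad_freq t) * x))"
  have *: "(saw_poly K has_real_derivative - (\<Sum>t\<in>?N. ?cos t) / energy K) (at x)"
    unfolding saw_poly_def
    using assms by (auto intro!: derivative_eq_intros sum.cong simp: divide_simps)
  have "norm (dirichlet_sum K x) ^ 4 = (\<Sum>t\<in>?C. ?cos t) + (\<Sum>t\<in>?N. ?cos t)"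
    unfolding dirichlet_sum_norm_pow4
    by (subst sum.union_disjoint[symmetric]) (auto intro!: sum.cong)
  moreover have "(\<Sum>t\<in>?C. ?cos t) = energy K"
    by (simp add: energy_def)
  ultimately have "1 - norm (dirichlet_sum K x) ^ 4 / energy K = - (\<Sum>t\<in>?N. ?cos t) / energy K"
    using assms by (simp add: add_divide_distrib)
  with * show ?thesis
    by simp
qed

lemma saw_poly_add_of_int: "saw_poly K (x + of_int m) = saw_poly K x"
proof -
  have "sin (2 * pi * (of_int k * (x + of_int m))) = sin (2 * pi * (of_int k * x))" for k
  proof -
    have "unit_char (of_int k * (x + of_int m)) = unit_char (of_int k * x)"
      using unit_char_of_int[of "k * m"] by (simp add: distrib_left unit_char_add)
    then show ?thesis
      by (metis Im_unit_char)
  qed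
  then show ?thesis
    by (simp add: saw_poly_def)
qed

lemma saw_poly_minus: "saw_poly K (- x) = - saw_poly K x"
  by (simp add: saw_poly_def sum_negf)

lemma saw_poly_half: "saw_poly K (1 / 2) = 0"
  using saw_poly_add_of_int[of K "- 1/2" 1] saw_poly_minus[of K "1/2"] by simp

text \<open>
  The decay of order \<open>x\<^sup>-\<^sup>4\<close> is the reason for using a fourth power: its antiderivative still decays
  faster than \<open>x\<^sup>-\<^sup>2\<close>, and so the approximation error has a majorant of mean value \<open>O(1/K)\<close>.
\<close>

lemma dirichlet_sum_pow4_le:
  assumes "0 < x" "x \<le> 1 / 2"
  shows "norm (dirichlet_sum K x) ^ 4 \<le> 1 / x ^ 4"
proof -
  have "norm (dirichlet_sum K x) * (2 * x) \<le> norm (dirichlet_sum K x) * norm (1 - unit_char x)"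
    using assms norm_one_minus_unit_char_ge[of x] by (intro mult_left_mono) auto
  also have "\<dots> \<le> 1 + 1"
    unfolding dirichlet_sum_mult by (rule order.trans[OF norm_triangle_ineq4]) simp
  finally have "norm (dirichlet_sum K x) \<le> 1 / x"
    using assms by (simp add: field_simps)
  then show ?thesis
    using power_mono[of "norm (dirichlet_sum K x)" "1 / x" 4] by (simp add: power_divide)
qed

lemma saw_poly_0 [simp]: "saw_poly K 0 = 0"
  by (simp add: saw_poly_def)

text \<open>
  The error \<open>s - s\<^sub>K\<close> has the Jackson kernel as derivative on \<open>(0, 1/2]\<close> and vanishes at \<open>1/2\<close>. As
  the kernel is positive, the error increases from \<open>-1/2\<close> to \<open>0\<close>; as the kernel is
  \<open>O(1/(K\<^sup>3 x\<^sup>4))\<close>, the error is \<open>O(1/(K x)\<^sup>3)\<close>. The first estimate is used for \<open>K x \<le> 1\<close>, the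
  second one beyond.
\<close>

lemma saw_minus_saw_poly_pos:
  assumes K: "K > 0" and E: "real K ^ 3 \<le> 27 * energy K" and x: "0 < x" "x \<le> 1 / 2"
  shows "\<bar>saw x - saw_poly K x\<bar> \<le> 81 / (real K * x + 1 / 2) ^ 2"
proof -
  define err where "err t = t - 1 / 2 - saw_poly K t" for t
  have pos: "energy K > 0"
    using E K zero_less_power[of "real K" 3] by linarith
  have deriv: "(err has_real_derivative norm (dirichlet_sum K t) ^ 4 / energy K) (at t)" for t
    unfolding err_def by (auto intro!: derivative_eq_intros saw_poly_deriv[OF pos])
  have mono: "err a \<le> err b" if "a \<le> b" for a b
    by (rule DERIV_nonneg_imp_nondecreasing[OF that]) (use deriv pos in \<open>auto intro!: exI\<close>)
  have ends: "err 0 = - 1 / 2" "err (1 / 2) = 0"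
    by (simp_all add: err_def saw_poly_half)
  have nonpos: "err x \<le> 0" and half: "- 1 / 2 \<le> err x"
    using mono[of x "1 / 2"] mono[of 0 x] ends x by auto
  \<comment> \<open>The antiderivative of the bound \<open>1 / (energy K * t ^ 4)\<close> on the kernel is \<open>- c / t ^ 3\<close>.\<close>
  define c where "c = 1 / (3 * energy K)"
  have "err (1 / 2) + c * inverse (1 / 2) ^ 3 \<le> err x + c * inverse x ^ 3"
  proof (rule DERIV_nonpos_imp_nonincreasing[OF x(2)])
    fix t assume t: "x \<le> t" "t \<le> 1 / 2"
    have "((\<lambda>t. c * inverse t ^ 3) has_real_derivative
        - (c * (3 * (inverse t ^ 2 * inverse t ^ 2)))) (at t)"
      using t x by (auto intro!: derivative_eq_intros simp: power2_eq_square)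
    from DERIV_add[OF deriv this]
    have "((\<lambda>t. err t + c * inverse t ^ 3) has_real_derivative
        norm (dirichlet_sum K t) ^ 4 / energy K + - (c * (3 * (inverse t ^ 2 * inverse t ^ 2)))) (at t)" .
    moreover have "norm (dirichlet_sum K t) ^ 4 / energy K \<le> (1 / t ^ 4) / energy K"
      using dirichlet_sum_pow4_le[of t K] t x pos by (intro divide_right_mono) auto
    moreover have "(1 / t ^ 4) / energy K = c * (3 * (inverse t ^ 2 * inverse t ^ 2))"
    proof -
      have "inverse t ^ 2 * inverse t ^ 2 = inverse t ^ (2 + 2)"
        by (simp only: power_add)
      also have "\<dots> = 1 / t ^ 4"
        by (simp only: power_inverse divide_inverse mult_1_left) simp
      finally show ?thesis
        by (simp add: c_def)
    qed
    ultimately show "\<exists>y. ((\<lambda>t. err t + c * inverse t ^ 3) has_real_derivative y) (at t) \<and> y \<le> 0"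
      by force
  qed
  moreover have "c > 0"
    using pos by (simp add: c_def)
  moreover have "c * inverse x ^ 3 = c / x ^ 3"
    by (simp only: power_inverse divide_inverse)
  ultimately have cubic: "- err x \<le> c / x ^ 3"
    by (simp add: ends)
  \<comment> \<open>The constant 81 is \<open>9 * 3 ^ 2\<close>: by hypothesis \<open>c \<le> 9 / K ^ 3\<close>, and \<open>y + 1 / 2 \<le> 3 * y\<close> for \<open>y > 1\<close>.\<close>
  have "\<bar>err x\<bar> \<le> 81 / (real K * x + 1 / 2) ^ 2"
  proof (cases "real K * x \<le> 1")
    case True
    then have "(real K * x + 1 / 2) ^ 2 \<le> (3 / 2) ^ 2"
      using x by (intro power_mono) auto
    moreover have "(real K * x + 1 / 2) ^ 2 > 0"
      using x by (intro zero_less_power add_nonneg_pos) auto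
    ultimately have "1 / 2 \<le> 81 / (real K * x + 1 / 2) ^ 2"
      by (simp add: field_simps)
    then show ?thesis
      using nonpos half by simp
  next
    case False
    define y where "y = real K * x"
    have y: "y > 1"
      using False by (simp add: y_def)
    have "c / x ^ 3 \<le> 9 / y ^ 3"
      using E pos K x by (simp add: c_def y_def power_mult_distrib field_simps)
    also have "\<dots> \<le> 9 / y ^ 2"
      using y by (intro divide_left_mono power_increasing) auto
    also have "\<dots> \<le> 81 / (y + 1 / 2) ^ 2"
    proof -
      have "(y + 1 / 2) ^ 2 \<le> (3 * y) ^ 2"
        using y by (intro power_mono) auto
      then show ?thesis
        using y by (simp add: field_simps)
    qed
    finally show ?thesis
      using nonpos cubic by (simp add: y_def)
  qed
  moreover have "saw x = x - 1 / 2"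
    using x by (simp add: saw_def frac_eq[THEN iffD2])
  ultimately show ?thesis
    using pos by (simp add: err_def)
qed

text \<open>
  The Fejer kernel at \<open>x\<close> has a numerator \<open>1 - cos(2 \<pi> K x)\<close> with zeros, so it bounds nothing
  from above by itself. A translation by half a period changes the sign of the cosine, and the two
  numerators add up to a constant.
\<close>

lemma inverse_square_le_dirichlet_sums:
  assumes "K > 0"
  shows "1 / (real K * \<bar>x\<bar> + 1 / 2) ^ 2
    \<le> pi ^ 2 / real K ^ 2
        * (norm (dirichlet_sum K x) ^ 2 + norm (dirichlet_sum K (x + 1 / (2 * real K))) ^ 2)"
proof -
  define z where "z = x + 1 / (2 * real K)"
  define r where "r = \<bar>x\<bar> + 1 / (2 * real K)"
  have "1 / (2 * real K) > 0"
    using assms by simp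
  then have r: "\<bar>x\<bar> \<le> r" "\<bar>z\<bar> \<le> r" "r > 0"
    unfolding r_def z_def by linarith+
  have le: "2 - 2 * cos (2 * pi * (real K * t)) \<le> norm (dirichlet_sum K t) ^ 2 * (2 * pi * r) ^ 2"
    if "\<bar>t\<bar> \<le> r" for t
  proof -
    have "norm (1 - unit_char t) \<le> 2 * pi * r"
      using that by (intro order.trans[OF norm_one_minus_unit_char_le]) auto
    then have "norm (1 - unit_char t) ^ 2 \<le> (2 * pi * r) ^ 2"
      by (intro power_mono) auto
    then have "(norm (dirichlet_sum K t) * norm (1 - unit_char t)) ^ 2
        \<le> norm (dirichlet_sum K t) ^ 2 * (2 * pi * r) ^ 2"
      unfolding power_mult_distrib[of "norm _"] by (intro mult_left_mono) auto
    then show ?thesis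
      by (simp add: dirichlet_sum_mult norm_one_minus_unit_char_sq)
  qed
  have "2 * pi * (real K * z) = 2 * pi * (real K * x) + pi"
    using assms by (simp add: z_def field_simps)
  then have "cos (2 * pi * (real K * z)) = - cos (2 * pi * (real K * x))"
    by simp
  with le[OF r(1)] le[OF r(2)]
  have "4 \<le> (norm (dirichlet_sum K x) ^ 2 + norm (dirichlet_sum K z) ^ 2) * (2 * pi * r) ^ 2"
    by (simp add: distrib_right)
  also have "\<dots> = 4 * (pi ^ 2 * (norm (dirichlet_sum K x) ^ 2 + norm (dirichlet_sum K z) ^ 2)) * r ^ 2"
    by (simp add: power_mult_distrib)
  finally have "1 / r ^ 2 \<le> pi ^ 2 * (norm (dirichlet_sum K x) ^ 2 + norm (dirichlet_sum K z) ^ 2)"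
    using r by (simp add: divide_le_eq)
  moreover have "real K * \<bar>x\<bar> + 1 / 2 = real K * r"
    using assms by (simp add: r_def field_simps)
  ultimately show ?thesis
    using divide_right_mono[of "1 / r ^ 2" _ "real K ^ 2"]
    by (simp add: z_def power_mult_distrib mult.commute)
qed

text \<open>
  Both sides have period 1, so \<open>x\<close> may be moved to \<open>[-1/2, 1/2]\<close>. There the left-hand side is even
  away from 0; at 0 itself the sawtooth function has its jump and the error is exactly \<open>1/2\<close>.
\<close>

lemma saw_minus_saw_poly_le:
  assumes K: "K > 0" and E: "real K ^ 3 \<le> 27 * energy K"
  shows "\<bar>saw x - saw_poly K x\<bar> \<le> 81 * pi ^ 2 / real K ^ 2
     * (norm (dirichlet_sum K x) ^ 2 + norm (dirichlet_sum K (x + 1 / (2 * real K))) ^ 2)"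
proof -
  define m where "m = round x"
  define y where "y = x - of_int m"
  have x: "x = y + of_int m"
    by (simp add: y_def)
  have y: "\<bar>y\<bar> \<le> 1 / 2"
    using of_int_round_abs_le[of x] by (simp add: y_def m_def abs_minus_commute)
  have shift: "saw x = saw y" "saw_poly K x = saw_poly K y"
    "dirichlet_sum K x = dirichlet_sum K y"
    "dirichlet_sum K (x + 1 / (2 * real K)) = dirichlet_sum K (y + 1 / (2 * real K))"
    using dirichlet_sum_add_of_int[of K "y + 1 / (2 * real K)" m]
    by (simp_all add: x saw_def saw_poly_add_of_int dirichlet_sum_add_of_int add_ac frac_def)
  have "\<bar>saw y - saw_poly K y\<bar> \<le> 81 * (1 / (real K * \<bar>y\<bar> + 1 / 2) ^ 2)"
  proof (cases y "0 :: real" rule: linorder_cases)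
    case less
    have "\<lfloor>y\<rfloor> = - 1" "\<lfloor>- y\<rfloor> = 0"
      using less y by (auto simp: floor_eq_iff)
    then have "saw y = - saw (- y)"
      by (simp add: saw_def frac_def)
    then show ?thesis
      using saw_minus_saw_poly_pos[OF assms, of "- y"] less y
      by (simp add: saw_poly_minus abs_minus_commute)
  next
    case equal
    then show ?thesis
      by (simp add: saw_def power2_eq_square)
  next
    case greater
    then show ?thesis
      using saw_minus_saw_poly_pos[OF assms, of y] y by simp
  qed
  also have "\<dots> \<le> 81 * (pi ^ 2 / real K ^ 2
      * (norm (dirichlet_sum K y) ^ 2 + norm (dirichlet_sum K (y + 1 / (2 * real K))) ^ 2))"
    by (intro mult_left_mono inverse_square_le_dirichlet_sums K) auto
  finally show ?thesis
    by (simp add: shift)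
qed

lemma norm_sum_unit_char_le_of_pos:
  assumes B: "\<And>m. \<lbrakk>0 < m; m \<le> M\<rbrakk> \<Longrightarrow> norm (\<Sum>j\<in>J. unit_char (real m * y j)) \<le> B"
    and k: "k \<noteq> 0" "\<bar>k\<bar> \<le> int M"
  shows "norm (\<Sum>j\<in>J. unit_char (of_int k * y j)) \<le> B"
proof -
  define m where "m = nat \<bar>k\<bar>"
  have m: "0 < m" "m \<le> M"
    using k by (auto simp: m_def)
  have "k = int m \<or> k = - int m"
    by (simp add: m_def abs_if)
  then consider "k = int m" | "k = - int m"
    by blast
  then show ?thesis
  proof cases
    case 1
    then show ?thesis
      using B[OF m] by simp
  next
    case 2
    then have "(\<Sum>j\<in>J. unit_char (of_int k * y j)) = cnj (\<Sum>j\<in>J. unit_char (real m * y j))"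
      by (simp add: cnj_unit_char)
    then show ?thesis
      using B[OF m] by (simp only: complex_mod_cnj)
  qed
qed

text \<open>
  Of the \<open>K\<^sup>2\<close> frequencies the \<open>K\<close> diagonal ones vanish and contribute \<open>card J\<close> each; every other
  one contributes at most \<open>B\<close>.
\<close>

lemma sum_dirichlet_sum_sq_le:
  assumes "B \<ge> 0"
    and B: "\<And>k :: int. \<lbrakk>k \<noteq> 0; \<bar>k\<bar> \<le> int K\<rbrakk>
      \<Longrightarrow> norm (\<Sum>j\<in>J. unit_char (of_int k * y j)) \<le> B"
  shows "(\<Sum>j\<in>J. norm (dirichlet_sum K (y j + s)) ^ 2) \<le> real K * real (card J) + real K ^ 2 * B"
proof -
  let ?S = "\<lambda>p. \<Sum>j\<in>J. unit_char (of_int (pair_freq p) * (y j + s))"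
  have S: "norm (?S p) \<le> (if pair_freq p = 0 then real (card J) else 0) + B"
    if "p \<in> pairs K" for p
  proof (cases "pair_freq p = 0")
    case True
    then show ?thesis
      using \<open>B \<ge> 0\<close> by simp
  next
    case False
    have "?S p = unit_char (of_int (pair_freq p) * s)
        * (\<Sum>j\<in>J. unit_char (of_int (pair_freq p) * y j))"
      by (simp add: distrib_left unit_char_add sum_distrib_left mult.commute)
    moreover have "\<bar>pair_freq p\<bar> \<le> int K"
      using that by (auto simp: pair_freq_def)
    ultimately show ?thesis
      using False B by (simp add: norm_mult)
  qed
  have "complex_of_real (\<Sum>j\<in>J. norm (dirichlet_sum K (y j + s)) ^ 2) = (\<Sum>p\<in>pairs K. ?S p)"
    by (simp only: of_real_sum dirichlet_sum_norm_sq) (rule sum.swap)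
  then have "\<bar>\<Sum>j\<in>J. norm (dirichlet_sum K (y j + s)) ^ 2\<bar> = norm (\<Sum>p\<in>pairs K. ?S p)"
    by (metis norm_of_real)
  also have "\<dots> \<le> (\<Sum>p\<in>pairs K. (if pair_freq p = 0 then real (card J) else 0) + B)"
    by (intro sum_norm_le S)
  also have "\<dots> = real (card {p \<in> pairs K. pair_freq p = 0}) * real (card J) + real K ^ 2 * B"
    by (simp add: sum.distrib sum.If_cases Int_def conj_commute card_cartesian_product
        power2_eq_square)
  also have "{p \<in> pairs K. pair_freq p = 0} = (\<lambda>k. (k, k)) ` {..<K}"
    by (auto simp: pair_freq_def)
  also have "card \<dots> = K"
    by (subst card_image) (auto simp: inj_on_def)
  finally show ?thesis
    by simp
qed

lemma sum_saw_poly_le: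
  assumes "energy K > 0" "B \<ge> 0"
    and B: "\<And>k :: int. \<lbrakk>k \<noteq> 0; \<bar>k\<bar> \<le> 2 * int K\<rbrakk>
      \<Longrightarrow> norm (\<Sum>j\<in>J. unit_char (of_int k * y j)) \<le> B"
  shows "\<bar>\<Sum>j\<in>J. saw_poly K (y j)\<bar> \<le> real K ^ 4 * B / energy K"
proof -
  let ?N = "{t \<in> quads K. quad_freq t \<noteq> 0}"
  let ?S = "\<lambda>t. (\<Sum>j\<in>J. sin (2 * pi * (of_int (quad_freq t) * y j)))
    / (2 * pi * of_int (quad_freq t))"
  have S: "\<bar>?S t\<bar> \<le> B" if "t \<in> ?N" for t
  proof -
    let ?k = "quad_freq t"
    have k: "?k \<noteq> 0" "\<bar>?k\<bar> \<le> 2 * int K"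
      using that by (auto simp: quad_freq_def pair_freq_def)
    have "\<bar>\<Sum>j\<in>J. sin (2 * pi * (of_int ?k * y j))\<bar> = \<bar>Im (\<Sum>j\<in>J. unit_char (of_int ?k * y j))\<bar>"
      by (simp add: Im_unit_char)
    also have "\<dots> \<le> B"
      using B[OF k] by (rule order.trans[OF abs_Im_le_cmod])
    finally have num: "\<bar>\<Sum>j\<in>J. sin (2 * pi * (of_int ?k * y j))\<bar> \<le> B" .
    have "1 \<le> real_of_int \<bar>?k\<bar>"
      using k by linarith
    then have "1 * 1 \<le> 2 * pi * real_of_int \<bar>?k\<bar>"
      using pi_ge_two by (intro mult_mono) auto
    then have "1 \<le> \<bar>2 * pi * of_int ?k\<bar>"
      by (simp add: abs_mult)
    then have "\<bar>\<Sum>j\<in>J. sin (2 * pi * (of_int ?k * y j))\<bar> / \<bar>2 * pi * of_int ?k\<bar> \<le> B / 1"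
      using num by (intro frac_le) auto
    then show ?thesis
      by (simp add: abs_divide)
  qed
  have "(\<Sum>j\<in>J. saw_poly K (y j)) = - (\<Sum>t\<in>?N. ?S t) / energy K"
    unfolding saw_poly_def sum_divide_distrib[symmetric] sum_negf
    by (subst sum.swap) (simp add: sum_divide_distrib)
  then have "\<bar>\<Sum>j\<in>J. saw_poly K (y j)\<bar> = \<bar>\<Sum>t\<in>?N. ?S t\<bar> / energy K"
    using assms(1) by (simp add: abs_divide)
  also have "\<bar>\<Sum>t\<in>?N. ?S t\<bar> \<le> (\<Sum>t\<in>?N. B)"
    using S by (intro order.trans[OF sum_abs] sum_mono)
  also have "\<dots> \<le> (\<Sum>t\<in>quads K. B)"
    using \<open>B \<ge> 0\<close> by (intro sum_mono2) auto
  also have "\<dots> = real K ^ 4 * B"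
    by (simp add: card_cartesian_product eval_nat_numeral)
  finally show ?thesis
    using assms(1) by (simp add: divide_right_mono)
qed

text \<open>
  A discrepancy estimate in the style of Erdos and Turan. The approximating polynomial contributes the
  term \<open>K B\<close>, and the mean value of the majorant of the error contributes \<open>card J / K\<close>. That \<open>K\<close> is a
  multiple of 3 serves only the lower bound on the energy.
\<close>

proposition sum_saw_le:
  assumes K: "K = 3 * n" "n > 0" and "B \<ge> 0"
    and B: "\<And>m. \<lbrakk>0 < m; m \<le> 2 * K\<rbrakk> \<Longrightarrow> norm (\<Sum>j\<in>J. unit_char (real m * y j)) \<le> B"
  shows "\<bar>\<Sum>j\<in>J. saw (y j)\<bar> \<le> 3000 * (real (card J) / real K + real K * B)"
proof -
  have pos: "K > 0" "real K \<ge> 1"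
    using K by auto
  have E: "real K ^ 3 \<le> 27 * energy K"
    using energy_ge[of n] K by (simp add: power_mult_distrib)
  then have E0: "energy K > 0"
    using zero_less_power[of "real K" 3] pos by linarith
  have B': "norm (\<Sum>j\<in>J. unit_char (of_int k * y j)) \<le> B" if "k \<noteq> 0" "\<bar>k\<bar> \<le> 2 * int K" for k
    using that by (intro norm_sum_unit_char_le_of_pos[of "2 * K"] B) auto
  let ?D = "\<lambda>s. \<Sum>j\<in>J. norm (dirichlet_sum K (y j + s)) ^ 2"
  have D: "?D s \<le> real K * real (card J) + real K ^ 2 * B" for s
    using \<open>B \<ge> 0\<close> B' by (intro sum_dirichlet_sum_sq_le) auto
  have "\<bar>\<Sum>j\<in>J. saw_poly K (y j)\<bar> \<le> real K ^ 4 * B / energy K"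
    using E0 \<open>B \<ge> 0\<close> B' by (rule sum_saw_poly_le)
  also have "\<dots> \<le> 27 * (real K * B)"
  proof -
    have "real K ^ 4 * B = real K ^ 3 * (real K * B)"
      by (simp add: eval_nat_numeral)
    also have "\<dots> \<le> 27 * energy K * (real K * B)"
      using E \<open>B \<ge> 0\<close> by (intro mult_right_mono) auto
    finally show ?thesis
      using E0 by (simp add: divide_le_eq mult_ac)
  qed
  finally have poly: "\<bar>\<Sum>j\<in>J. saw_poly K (y j)\<bar> \<le> 27 * (real K * B)" .
  have "\<bar>\<Sum>j\<in>J. saw (y j) - saw_poly K (y j)\<bar> \<le> (\<Sum>j\<in>J. 81 * pi ^ 2 / real K ^ 2
      * (norm (dirichlet_sum K (y j)) ^ 2 + norm (dirichlet_sum K (y j + 1 / (2 * real K))) ^ 2))"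
    by (intro order.trans[OF sum_abs] sum_mono saw_minus_saw_poly_le pos E)
  also have "\<dots> = 81 * pi ^ 2 / real K ^ 2 * (?D 0 + ?D (1 / (2 * real K)))"
    by (simp only: sum_distrib_left[symmetric] sum.distrib add_0_right)
  also have "\<dots> \<le> 81 * pi ^ 2 / real K ^ 2 * (2 * (real K * real (card J) + real K ^ 2 * B))"
    using D[of 0] D[of "1 / (2 * real K)"] by (intro mult_left_mono) auto
  also have "\<dots> = 162 * pi ^ 2 * (real (card J) / real K + B)"
    using pos by (simp add: field_simps power2_eq_square)
  also have "\<dots> \<le> 162 * 4 ^ 2 * (real (card J) / real K + real K * B)"
    using pos \<open>B \<ge> 0\<close> pi_less_4 mult_right_mono[of 1 "real K" B]
    by (intro mult_mono power_mono add_mono) auto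
  finally have "\<bar>(\<Sum>j\<in>J. saw (y j)) - (\<Sum>j\<in>J. saw_poly K (y j))\<bar>
      \<le> 2592 * (real (card J) / real K + real K * B)"
    by (simp add: sum_subtractf)
  with poly have "\<bar>\<Sum>j\<in>J. saw (y j)\<bar>
      \<le> 27 * (real K * B) + 2592 * (real (card J) / real K + real K * B)"
    by linarith
  \<comment> \<open>The constants add up to \<open>27 + 162 * 4 ^ 2 = 2619\<close>, rounded up.\<close>
  also have "\<dots> \<le> 3000 * (real (card J) / real K + real K * B)"
    using pos \<open>B \<ge> 0\<close> by (simp add: field_simps)
  finally show ?thesis .
qed

section \<open>Counting angles in an interval\<close>

text \<open>
  The sawtooth terms leave the integer \<open>\<lfloor>\<beta>/2 - t\<rfloor> + \<lfloor>\<beta>/2 + t\<rfloor> + 1\<close>, the number of integers \<open>m\<close> with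
  \<open>t + m\<close> in the interval. It is at most 1 because \<open>\<beta> < 1\<close>. The end points count as
  inside because the floor function takes the upper of the two values at a jump.
\<close>

lemma interval_indicator_eq_saw:
  assumes "0 < \<beta>" "\<beta> < 1"
  shows "(if \<exists>m::int. t + of_int m \<in> {-\<beta>/2..\<beta>/2} then 1 else 0)
    = \<beta> - saw (\<beta> / 2 - t) - saw (\<beta> / 2 + t)"
proof -
  define a b where "a = \<lfloor>\<beta> / 2 - t\<rfloor>" and "b = \<lfloor>\<beta> / 2 + t\<rfloor>"
  have ab: "of_int a \<le> \<beta> / 2 - t" "\<beta> / 2 - t < of_int a + 1"
    "of_int b \<le> \<beta> / 2 + t" "\<beta> / 2 + t < of_int b + 1"
    by (simp_all add: a_def b_def)
  have rhs: "\<beta> - saw (\<beta> / 2 - t) - saw (\<beta> / 2 + t) = of_int (a + b + 1)"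
    by (simp add: saw_def frac_def a_def b_def)
  have bounds: "a + b < 1" "a + b > - 2"
    using ab assms by linarith+
  show ?thesis
  proof (cases "\<exists>m::int. t + of_int m \<in> {-\<beta>/2..\<beta>/2}")
    case True
    then obtain m :: int where m: "- \<beta> / 2 \<le> t + of_int m" "t + of_int m \<le> \<beta> / 2"
      by auto
    have "m \<le> a"
      unfolding a_def le_floor_iff using m by linarith
    moreover have "- m \<le> b"
      unfolding b_def le_floor_iff using m by simp
    ultimately have "a + b = 0"
      using bounds by linarith
    with True rhs show ?thesis
      by simp
  next
    case False
    then have "t + of_int a \<notin> {-\<beta>/2..\<beta>/2}"
      by blast
    then have "a + b < 0"
      using ab by auto
    then have "a + b = - 1"
      using bounds by linarith
    with False rhs show ?thesis
      by simp
  qed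
qed

lemma angle_count_eq_saw:
  assumes "0 < \<beta>" "\<beta> < 1"
  shows "real (angle_count {-\<beta>/2..\<beta>/2} g \<theta>) - 2 * real g * \<beta>
    = - (\<Sum>j = 1..2 * g. saw (\<beta> / 2 - \<theta> j)) - (\<Sum>j = 1..2 * g. saw (\<beta> / 2 + \<theta> j))"
proof -
  have "real (angle_count {-\<beta>/2..\<beta>/2} g \<theta>)
      = (\<Sum>j = 1..2 * g. if \<exists>m::int. \<theta> j + of_int m \<in> {-\<beta>/2..\<beta>/2} then 1 else 0)"
    by (simp add: angle_count_def sum.If_cases Int_def)
  also have "\<dots> = (\<Sum>j = 1..2 * g. \<beta> - saw (\<beta> / 2 - \<theta> j) - saw (\<beta> / 2 + \<theta> j))"
    by (intro sum.cong refl interval_indicator_eq_saw assms)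
  finally show ?thesis
    by (simp add: sum_subtractf)
qed

lemma angle_count_bound:
  fixes Q :: "'a::{field,finite} poly"
  assumes \<beta>: "0 < \<beta>" "\<beta> < 1" and Q: "angles_of Q g \<theta>" and n: "n > 0"
  defines "A \<equiv> 2 * real CARD('a) ^ 2"
  shows "\<bar>real (angle_count {-\<beta>/2..\<beta>/2} g \<theta>) - 2 * real g * \<beta>\<bar>
    \<le> 6000 * (2 * real g / (3 * real n) + 3 * real n * A ^ (6 * n))"
proof -
  let ?J = "{1..2 * g}"
  have "1 \<le> real CARD('a)"
    by (simp add: Suc_le_eq)
  then have "1 \<le> real CARD('a) ^ 2"
    by (rule one_le_power)
  then have A: "1 \<le> A"
    unfolding A_def by linarith
  have plus: "norm (\<Sum>j\<in>?J. unit_char (real m * \<theta> j)) \<le> A ^ (6 * n)"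
    if "0 < m" "m \<le> 6 * n" for m
  proof -
    have "norm (\<Sum>j\<in>?J. unit_char (real m * \<theta> j)) \<le> A ^ m"
      using norm_angle_power_sum_le[OF Q that(1)] by (simp add: unit_char_def A_def)
    also have "\<dots> \<le> A ^ (6 * n)"
      using that A by (intro power_increasing)
    finally show ?thesis .
  qed
  have minus: "norm (\<Sum>j\<in>?J. unit_char (real m * - \<theta> j)) \<le> A ^ (6 * n)"
    if "0 < m" "m \<le> 6 * n" for m
    using norm_sum_unit_char_le_of_pos[of "6 * n" \<theta> ?J _ "- int m"] plus that by simp
  have shift: "norm (\<Sum>j\<in>?J. unit_char (real m * (\<beta> / 2 + \<phi> j)))
      = norm (\<Sum>j\<in>?J. unit_char (real m * \<phi> j))" for m \<phi>
    by (simp add: distrib_left unit_char_add norm_mult flip: sum_distrib_left)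
  have saw: "\<bar>\<Sum>j\<in>?J. saw (\<beta> / 2 + \<phi> j)\<bar>
      \<le> 3000 * (2 * real g / (3 * real n) + 3 * real n * A ^ (6 * n))"
    if \<phi>: "\<And>m. \<lbrakk>0 < m; m \<le> 6 * n\<rbrakk> \<Longrightarrow> norm (\<Sum>j\<in>?J. unit_char (real m * \<phi> j)) \<le> A ^ (6 * n)"
    for \<phi>
  proof -
    have "norm (\<Sum>j\<in>?J. unit_char (real m * (\<beta> / 2 + \<phi> j))) \<le> A ^ (6 * n)"
      if "0 < m" "m \<le> 2 * (3 * n)" for m
      unfolding shift using that by (intro \<phi>) auto
    with sum_saw_le[OF refl n, where B = "A ^ (6 * n)" and J = ?J and y = "\<lambda>j. \<beta> / 2 + \<phi> j"] A
    show ?thesis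
      by simp
  qed
  show ?thesis
    using saw[OF plus] saw[OF minus] unfolding angle_count_eq_saw[OF \<beta>] add_uminus_conv_diff
    by linarith
qed

text \<open>
  The cutoff \<open>3 n\<close>, with \<open>n\<close> about \<open>c log g\<close>, balances \<open>g/n\<close> against \<open>n A\<^bsup>6 n\<^esup>\<close>. For
  \<open>c = 1/(12 log A)\<close> the power \<open>A\<^bsup>6 n\<^esup>\<close> is at most the square root of \<open>g\<close>, so that the first term
  dominates.
\<close>

lemma angle_count_discrepancy:
  fixes \<beta> :: real
  assumes \<beta>: "0 < \<beta>" "\<beta> < 1"
  obtains C where "C > 0"
    "\<forall>\<^sub>F g in sequentially. \<forall>(Q :: 'a::{field,finite} poly) \<theta>. angles_of Q g \<theta> \<longrightarrow>
      \<bar>real (angle_count {-\<beta>/2..\<beta>/2} g \<theta>) - 2 * real g * \<beta>\<bar> \<le> C * (real g / ln (real g))"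
proof -
  define A where "A = 2 * real CARD('a) ^ 2"
  have "1 \<le> real CARD('a)"
    by (simp add: Suc_le_eq)
  then have "1 \<le> real CARD('a) ^ 2"
    by (rule one_le_power)
  then have A: "A > 1"
    unfolding A_def by linarith
  define c where "c = 1 / (12 * ln A)"
  have c: "c > 0"
    using A by (simp add: c_def)
  define C where "C = 6000 * (4 / (3 * c) + 3 * c)"
  have "\<forall>\<^sub>F g in sequentially. c * ln (real g) \<ge> 2"
    using c by real_asymp
  moreover have "\<forall>\<^sub>F g in sequentially. ln (real g) * ln (real g) \<le> sqrt (real g)"
    by real_asymp
  moreover have "\<forall>\<^sub>F g in sequentially. g > 1"
    by (rule eventually_gt_at_top)
  ultimately have "\<forall>\<^sub>F g in sequentially. \<forall>(Q :: 'a poly) \<theta>. angles_of Q g \<theta> \<longrightarrow>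
      \<bar>real (angle_count {-\<beta>/2..\<beta>/2} g \<theta>) - 2 * real g * \<beta>\<bar> \<le> C * (real g / ln (real g))"
  proof eventually_elim
    case (elim g)
    define l where "l = ln (real g)"
    have l: "l > 0" "c * l \<ge> 2" "l * l \<le> sqrt (real g)"
      using elim by (auto simp: l_def)
    define n where "n = nat \<lfloor>c * l\<rfloor>"
    have n: "real n \<le> c * l" "c * l / 2 \<le> real n" "n > 0"
      using l by (auto simp: n_def) linarith+
    have "A ^ (6 * n) = exp (ln A * real (6 * n))"
      using A by (simp add: exp_of_nat2_mult flip: powr_realpow) (simp add: powr_def mult_ac)
    also have "\<dots> \<le> exp (ln A * (6 * (c * l)))"
      using n A by (intro exp_mono mult_left_mono) auto
    also have "ln A * (6 * (c * l)) = l / 2"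
      using A by (simp add: c_def)
    also have "exp (l / 2) = sqrt (real g)"
      using elim by (simp add: l_def ln_sqrt[symmetric])
    finally have pow: "A ^ (6 * n) \<le> sqrt (real g)" .
    have "3 * real n * A ^ (6 * n) \<le> 3 * (c * l) * sqrt (real g)"
      using n pow A by (intro mult_mono) auto
    also have "\<dots> \<le> 3 * c * (real g / l)"
    proof -
      have "l * l * sqrt (real g) \<le> sqrt (real g) * sqrt (real g)"
        using l by (intro mult_right_mono) auto
      then have "l * sqrt (real g) \<le> real g / l"
        using l by (simp add: pos_le_divide_eq mult_ac)
      then show ?thesis
        using mult_left_mono[of "l * sqrt (real g)" "real g / l" "3 * c"] c
        by (simp add: mult.assoc)
    qed
    finally have second: "3 * real n * A ^ (6 * n) \<le> 3 * c * (real g / l)" .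
    have "2 * real g / (3 * real n) \<le> 2 * real g / (3 * (c * l / 2))"
      using n c l by (intro divide_left_mono mult_left_mono) auto
    also have "\<dots> = 4 / (3 * c) * (real g / l)"
      by simp
    finally have "2 * real g / (3 * real n) + 3 * real n * A ^ (6 * n)
        \<le> 4 / (3 * c) * (real g / l) + 3 * c * (real g / l)"
      using second by (rule add_mono)
    also have "\<dots> = (4 / (3 * c) + 3 * c) * (real g / l)"
      by (simp only: distrib_right)
    finally have "2 * real g / (3 * real n) + 3 * real n * A ^ (6 * n)
        \<le> (4 / (3 * c) + 3 * c) * (real g / l)" .
    from mult_left_mono[OF this, of 6000]
    have "6000 * (2 * real g / (3 * real n) + 3 * real n * A ^ (6 * n)) \<le> C * (real g / l)"
      by (simp only: C_def mult.assoc)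
    then show ?case
      using angle_count_bound[OF \<beta> _ n(3), where ?'a = 'a] unfolding A_def l_def
      by (meson order.trans)
  qed
  moreover have "C > 0"
    using c by (simp add: C_def add_pos_pos)
  ultimately show ?thesis
    using that by blast
qed

theorem proposition5p1:
  fixes \<beta> :: real
  assumes "odd CARD('a::{field,finite})"
    and "0 < \<beta>" and "\<beta> < 1"
  shows "(\<forall>\<epsilon>>0. \<forall>\<^sub>F g in sequentially.
           \<forall>Q \<in> (monic_squarefree_polys (2 * g + 2) :: 'a poly set). \<forall>\<theta>. angles_of Q g \<theta> \<longrightarrow>
             \<bar>real (angle_count {-\<beta>/2..\<beta>/2} g \<theta>) / (2 * real g * \<beta>) - 1\<bar> \<le> \<epsilon>)
       \<and> (\<exists>C. \<forall>\<^sub>F g in sequentially.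
           \<forall>Q \<in> (monic_squarefree_polys (2 * g + 2) :: 'a poly set). \<forall>\<theta>. angles_of Q g \<theta> \<longrightarrow>
             \<bar>real (angle_count {-\<beta>/2..\<beta>/2} g \<theta>) - 2 * real g * \<beta>\<bar> \<le> C * (real g / ln (real g)))"
proof -
  obtain C where C: "C > 0"
    and bound: "\<forall>\<^sub>F g in sequentially. \<forall>(Q :: 'a poly) \<theta>. angles_of Q g \<theta> \<longrightarrow>
      \<bar>real (angle_count {-\<beta>/2..\<beta>/2} g \<theta>) - 2 * real g * \<beta>\<bar> \<le> C * (real g / ln (real g))"
    using angle_count_discrepancy[OF assms(2,3), where ?'a = 'a] by blast
  have "\<forall>\<^sub>F g in sequentially.
      \<forall>Q \<in> (monic_squarefree_polys (2 * g + 2) :: 'a poly set). \<forall>\<theta>. angles_of Q g \<theta> \<longrightarrow>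
        \<bar>real (angle_count {-\<beta>/2..\<beta>/2} g \<theta>) / (2 * real g * \<beta>) - 1\<bar> \<le> \<epsilon>" if "\<epsilon> > 0" for \<epsilon>
  proof -
    have "\<forall>\<^sub>F g in sequentially. C / (2 * \<beta> * ln (real g)) \<le> \<epsilon>"
      using C \<open>\<epsilon> > 0\<close> \<open>0 < \<beta>\<close> by real_asymp
    moreover have "\<forall>\<^sub>F g in sequentially. g > 1"
      by (rule eventually_gt_at_top)
    ultimately show ?thesis
      using bound
    proof eventually_elim
      case (elim g)
      show ?case
      proof (intro ballI allI impI)
        fix Q :: "'a poly" and \<theta>
        assume "angles_of Q g \<theta>"
        let ?N = "real (angle_count {-\<beta>/2..\<beta>/2} g \<theta>)"
        have pos: "2 * real g * \<beta> > 0"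
          using elim assms by simp
        have "?N / (2 * real g * \<beta>) - 1 = (?N - 2 * real g * \<beta>) / (2 * real g * \<beta>)"
          using elim assms by (simp add: diff_divide_distrib)
        then have "\<bar>?N / (2 * real g * \<beta>) - 1\<bar> = \<bar>?N - 2 * real g * \<beta>\<bar> / (2 * real g * \<beta>)"
          using pos by (simp only: abs_divide abs_of_pos)
        also have "\<dots> \<le> C * (real g / ln (real g)) / (2 * real g * \<beta>)"
          using elim \<open>angles_of Q g \<theta>\<close> pos by (intro divide_right_mono) auto
        also have "\<dots> = C / (2 * \<beta> * ln (real g))"
          using elim by (simp add: field_simps)
        also have "\<dots> \<le> \<epsilon>"
          using elim by simp
        finally show "\<bar>?N / (2 * real g * \<beta>) - 1\<bar> \<le> \<epsilon>" .
      qed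
    qed
  qed
  moreover have "\<forall>\<^sub>F g in sequentially.
      \<forall>Q \<in> (monic_squarefree_polys (2 * g + 2) :: 'a poly set). \<forall>\<theta>. angles_of Q g \<theta> \<longrightarrow>
        \<bar>real (angle_count {-\<beta>/2..\<beta>/2} g \<theta>) - 2 * real g * \<beta>\<bar> \<le> C * (real g / ln (real g))"
    using bound by eventually_elim blast
  ultimately show ?thesis
    by blast
qed

end
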